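(* Let $n\geq 2$ and let $R\cong F_1\times F_2\times\cdots\times F_n$, where $F_1,\dots,F_n$ are finite fields. The graph $\Gamma'_{Reg}(R)$ does not contain an induced subgraph isomorphic to the house graph if and only if $R\cong\mathbb{F}_2\times\mathbb{F}_2$, or $R\cong\mathbb{F}_2\times\mathbb{F}_3$, or $R\cong\mathbb{F}_3\times\mathbb{F}_3$, or $R\cong\mathbb{F}_2\times\mathbb{F}_2\times\mathbb{F}_2$.
   Context: For a commutative von Neumann regular ring $R$ with identity (i.e. for every $x\in R$ there is $y\in R$ with $xyx=x$; finite products of fields are such rings), $\Gamma'_{Reg}(R)$ is the simple graph with vertex set $R\setminus\{0_R\}$ in which two distinct vertices $a,b$ are adjacent if and only if $aba=a$ or $bab=b$. The house graph is the graph on $5$ vertices obtained from the cycle $C_4$ by adding one new vertex adjacent to exactly two consecutive vertices of the cycle. $\mathbb{F}_q$ denotes the field with $q$ elements. *)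

theory Defs
  imports
    "HOL-Algebra.Chinese_Remainder"
    "HOL-Number_Theory.Residues"
    "Graph_Theory.Graph_Theory"
begin

text \<open>
  Simple graphs are represented, as in the library, by symmetric loop-free digraphs without
  parallel arcs; each undirected edge corresponds to two opposite arcs.
\<close>

definition reg_graph :: "('a, 'm) ring_scheme \<Rightarrow> 'a pair_pre_digraph" where
  "reg_graph R = \<lparr>
     pverts = carrier R - {\<zero>\<^bsub>R\<^esub>},
     parcs = {(a, b). a \<in> carrier R - {\<zero>\<^bsub>R\<^esub>} \<and> b \<in> carrier R - {\<zero>\<^bsub>R\<^esub>} \<and> a \<noteq> b \<and>
       (a \<otimes>\<^bsub>R\<^esub> b \<otimes>\<^bsub>R\<^esub> a = a \<or> b \<otimes>\<^bsub>R\<^esub> a \<otimes>\<^bsub>R\<^esub> b = b)}\<rparr>"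

text \<open>The cycle \<open>0 - 1 - 2 - 3 - 0\<close> with the roof \<open>4\<close> on the edge \<open>0 - 1\<close>.\<close>

definition house_graph :: "nat pair_pre_digraph" where
  "house_graph = mk_symmetric
     \<lparr>pverts = {0, 1, 2, 3, 4},
      parcs = {(0, 1), (1, 2), (2, 3), (3, 0), (4, 0), (4, 1)}\<rparr>"

definition contains_induced :: "('a, 'b) pre_digraph \<Rightarrow> ('c, 'd) pre_digraph \<Rightarrow> bool" where
  "contains_induced G H \<longleftrightarrow> (\<exists>K. induced_subgraph K G \<and> digraph_iso K H)"

lemma pair_graph_reg_graph:
  assumes "finite (carrier R)"
  shows "pair_graph (reg_graph R)"
proof -
  have "parcs (reg_graph R) \<subseteq> carrier R \<times> carrier R"
    by (auto simp: reg_graph_def)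
  then have "finite (parcs (reg_graph R))"
    using assms finite_subset by blast
  then show ?thesis
    using assms
    by unfold_locales (auto simp: reg_graph_def symmetric_def intro!: symI)
qed

lemma pair_graph_house_graph: "pair_graph house_graph"
  by unfold_locales (auto simp: house_graph_def mk_symmetric_def symmetric_def intro!: symI)

end

theory Submission
  imports Defs
begin

text \<open>
  In a product of fields, \<open>a\<close> and \<open>b\<close> are adjacent iff one of them is the componentwise inverse of
  the other on the support of the other. If a factor has an element \<open>u \<noteq> 0\<close> with \<open>u\<^sup>2 \<noteq> 1\<close>, then
  \<open>(u,1), (u\<^sup>-\<^sup>1,1), (u,0), (u\<^sup>-\<^sup>1,0)\<close> is a 4-cycle with roof \<open>(0,1)\<close>; otherwise every factor is
  \<open>{0, 1, -1}\<close>, and explicit houses built from these entries exclude four factors as well as three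
  factors one of which has \<open>1 \<noteq> -1\<close>. In the four remaining rings the graph is bipartite after
  removal of the dominating vertices, while every vertex of the house's triangle has a
  non-neighbour.
\<close>

section \<open>Induced containment as an embedding of vertices\<close>

text \<open>In a digraph whose arcs are pairs, an arc is determined by its ends, so the arc part of
  a digraph isomorphism carries no information of its own. All later arguments about houses
  therefore deal only with a vertex map \<open>p\<close> that preserves and reflects arcs.\<close>

lemma contains_induced_with_proj:
  assumes "wf_digraph (with_proj G)" "wf_digraph (with_proj H)"
  shows "contains_induced (with_proj G) (with_proj H) \<longleftrightarrow>
    (\<exists>p. inj_on p (pverts H) \<and> p ` pverts H \<subseteq> pverts G \<and>
      (\<forall>u \<in> pverts H. \<forall>v \<in> pverts H. (p u, p v) \<in> parcs G \<longleftrightarrow> (u, v) \<in> parcs H))"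
    (is "?L \<longleftrightarrow> ?R")
proof
  assume ?L
  then obtain K f where K: "induced_subgraph K (with_proj G)"
    and f: "pre_digraph.digraph_isomorphism K f" and H: "with_proj H = app_iso f K"
    unfolding contains_induced_def digraph_iso_def by blast
  define q where "q = iso_verts f"
  have sub: "verts K \<subseteq> pverts G" and tK: "tail K = fst" and hK: "head K = snd"
    and arcsK: "arcs K = {e \<in> parcs G. fst e \<in> verts K \<and> snd e \<in> verts K}"
    using K by (auto simp: induced_subgraph_def subgraph_def compatible_def)
  have inj: "inj_on q (verts K)"
    and ends: "\<And>a. a \<in> arcs K \<Longrightarrow> q (fst a) = iso_tail f (iso_arcs f a) \<and>
      q (snd a) = iso_head f (iso_arcs f a)"
    using f tK hK by (auto simp: pre_digraph.digraph_isomorphism_def q_def)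
  have HV: "pverts H = q ` verts K" and HA: "parcs H = iso_arcs f ` arcs K"
    and Ht: "iso_tail f = fst" and Hh: "iso_head f = snd"
    using H by (auto simp: with_proj_def app_iso_def q_def)
  \<comment> \<open>Tail and head are \<open>fst\<close> and \<open>snd\<close> on both sides, so
    compatibility with the ends fixes the image of each arc.\<close>
  have arc: "iso_arcs f a = (q (fst a), q (snd a))" if "a \<in> arcs K" for a
    using ends[OF that] Ht Hh by (simp add: prod_eq_iff)
  \<comment> \<open>The isomorphism runs from the subgraph \<open>K\<close> to \<open>H\<close>, the
    embedding in the opposite direction.\<close>
  define p where "p = the_inv_into (verts K) q"
  have pq: "p (q x) = x" if "x \<in> verts K" for x
    using that inj by (simp add: p_def the_inv_into_f_f)
  have arcs_iff: "(x, y) \<in> parcs G \<longleftrightarrow> (q x, q y) \<in> parcs H"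
    if x: "x \<in> verts K" and y: "y \<in> verts K" for x y
  proof
    assume "(x, y) \<in> parcs G"
    then have "(x, y) \<in> arcs K" using x y by (simp add: arcsK)
    then show "(q x, q y) \<in> parcs H" using arc[of "(x, y)"] HA by force
  next
    assume "(q x, q y) \<in> parcs H"
    then obtain a where a: "a \<in> arcs K" "(q x, q y) = iso_arcs f a" using HA by auto
    then have "q x = q (fst a)" "q y = q (snd a)" using arc by auto
    then have "x = fst a" "y = snd a"
      using a(1) x y inj by (auto simp: arcsK dest: inj_onD)
    then show "(x, y) \<in> parcs G" using a(1) by (simp add: arcsK)
  qed
  have "inj_on p (pverts H)" by (auto simp: inj_on_def HV pq)
  moreover have "p ` pverts H \<subseteq> pverts G" using sub by (auto simp: HV pq)
  ultimately show ?R using arcs_iff by (intro exI[of _ p]) (auto simp: HV pq)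
next
  assume ?R
  then obtain p where inj: "inj_on p (pverts H)" and sub: "p ` pverts H \<subseteq> pverts G"
    and arcs_iff: "\<And>u v. u \<in> pverts H \<Longrightarrow> v \<in> pverts H \<Longrightarrow>
      (p u, p v) \<in> parcs G \<longleftrightarrow> (u, v) \<in> parcs H"
    by blast
  interpret H: wf_digraph "with_proj H" by fact
  define q where "q = the_inv_into (pverts H) p"
  have qp: "q (p u) = u" if "u \<in> pverts H" for u
    using that inj by (simp add: q_def the_inv_into_f_f)
  \<comment> \<open>\<open>K\<close> is spanned in \<open>G\<close> by the image of
    \<open>p\<close>; the isomorphism onto \<open>H\<close> is the inverse \<open>q\<close> of
    \<open>p\<close>, applied to vertices and to both ends of arcs.\<close>
  define K where "K = with_proj \<lparr>pverts = p ` pverts H,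
    parcs = {e \<in> parcs G. fst e \<in> p ` pverts H \<and> snd e \<in> p ` pverts H}\<rparr>"
  have K_wf: "wf_digraph K" by unfold_locales (auto simp: K_def)
  have "induced_subgraph K (with_proj G)"
    using K_wf assms(1) sub by (auto simp: induced_subgraph_def subgraph_def K_def)
  moreover
  define f where "f = \<lparr>iso_verts = q, iso_arcs = map_prod q q, iso_head = snd, iso_tail = fst\<rparr>"
  have "pre_digraph.digraph_isomorphism K f"
    using K_wf
    by (auto simp: pre_digraph.digraph_isomorphism_def f_def K_def inj_on_def qp)
  moreover have "with_proj H = app_iso f K"
  proof -
    have "pverts H = q ` p ` pverts H" by (auto simp: image_image qp)
    moreover have "parcs H = map_prod q q `
      {e \<in> parcs G. fst e \<in> p ` pverts H \<and> snd e \<in> p ` pverts H}" (is "_ = _ ` ?A")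
    proof
      show "parcs H \<subseteq> map_prod q q ` ?A"
      proof
        fix e assume e: "e \<in> parcs H"
        obtain u v where uv: "e = (u, v)" by fastforce
        \<comment> \<open>Well-formedness of \<open>H\<close> enters here: \<open>arcs_iff\<close>
          speaks only of pairs of vertices, so every arc of \<open>H\<close> must have its ends in
          \<open>pverts H\<close>.\<close>
        have "u \<in> pverts H" "v \<in> pverts H"
          using H.tail_in_verts[of e] H.head_in_verts[of e] e uv by auto
        then show "e \<in> map_prod q q ` ?A"
          using arcs_iff e uv qp by (intro image_eqI[of _ _ "(p u, p v)"]) auto
      qed
      show "map_prod q q ` ?A \<subseteq> parcs H" using arcs_iff by (auto simp: qp)
    qed
    ultimately show ?thesis by (simp add: with_proj_def app_iso_def f_def K_def)
  qed
  ultimately show ?L unfolding contains_induced_def digraph_iso_def by blast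
qed

section \<open>Houses in the graph of a ring\<close>

lemma wf_digraph_reg_graph: "wf_digraph (with_proj (reg_graph R))"
  by unfold_locales (auto simp: reg_graph_def)

lemma wf_digraph_house_graph: "wf_digraph (with_proj house_graph)"
  by unfold_locales (auto simp: house_graph_def mk_symmetric_def)

lemma house_graph_simps:
  "pverts house_graph = {0, 1, 2, 3, 4}"
  "parcs house_graph = {(0, 1), (1, 2), (2, 3), (3, 0), (4, 0), (4, 1),
    (1, 0), (2, 1), (3, 2), (0, 3), (0, 4), (1, 4)}"
  by (auto simp: house_graph_def mk_symmetric_def)

abbreviation contains_house :: "('a, 'm) ring_scheme \<Rightarrow> bool" where
  "contains_house R \<equiv> contains_induced (with_proj (reg_graph R)) (with_proj house_graph)"

lemmas contains_house_iff =
  contains_induced_with_proj[OF wf_digraph_reg_graph wf_digraph_house_graph]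

text \<open>Adjacency is an equation between products, so an embedding of the house can be composed
  with a ring isomorphism. This allows each ring to be replaced by a convenient nested
  product.\<close>

lemma contains_house_iso:
  assumes "ring R" "ring S" "R \<simeq> S" "contains_house R"
  shows "contains_house S"
proof -
  obtain h where h: "h \<in> ring_hom R S" "bij_betw h (carrier R) (carrier S)"
    using assms(3) by (auto simp: is_ring_iso_def ring_iso_def)
  interpret R: ring R by fact
  have inj: "h x = h y \<longleftrightarrow> x = y" if "x \<in> carrier R" "y \<in> carrier R" for x y
    using h(2) that by (auto simp: bij_betw_def inj_on_def)
  have car: "h x \<in> carrier S" if "x \<in> carrier R" for x
    using h(1) that by (rule ring_hom_closed)
  \<comment> \<open>Applied from right to left below, so that being nonzero in \<open>S\<close> also
    reduces to injectivity of \<open>h\<close>.\<close>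
  have zero: "h \<zero>\<^bsub>R\<^esub> = \<zero>\<^bsub>S\<^esub>" using ring_hom_zero h(1) assms(1,2) by blast
  have arcs: "(h x, h y) \<in> parcs (reg_graph S) \<longleftrightarrow> (x, y) \<in> parcs (reg_graph R)"
    if "x \<in> carrier R" "y \<in> carrier R" for x y
  proof -
    have m: "h x \<otimes>\<^bsub>S\<^esub> h y \<otimes>\<^bsub>S\<^esub> h x = h (x \<otimes>\<^bsub>R\<^esub> y \<otimes>\<^bsub>R\<^esub> x)"
      "h y \<otimes>\<^bsub>S\<^esub> h x \<otimes>\<^bsub>S\<^esub> h y = h (y \<otimes>\<^bsub>R\<^esub> x \<otimes>\<^bsub>R\<^esub> y)"
      using that h(1) by (simp_all add: ring_hom_mult)
    show ?thesis
      using that unfolding reg_graph_def by (simp add: m inj car flip: zero)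
  qed
  from assms(4) obtain p where p: "inj_on p (pverts house_graph)"
    "p ` pverts house_graph \<subseteq> pverts (reg_graph R)"
    "\<forall>u \<in> pverts house_graph. \<forall>v \<in> pverts house_graph.
      (p u, p v) \<in> parcs (reg_graph R) \<longleftrightarrow> (u, v) \<in> parcs house_graph"
    unfolding contains_house_iff by blast
  have pR: "p u \<in> carrier R" "p u \<noteq> \<zero>\<^bsub>R\<^esub>" if "u \<in> pverts house_graph" for u
    using p(2) that by (auto simp: reg_graph_def)
  show ?thesis
    unfolding contains_house_iff
  proof (intro exI[of _ "h \<circ> p"] conjI ballI)
    show "inj_on (h \<circ> p) (pverts house_graph)"
      using p(1) pR(1) by (auto simp: inj_on_def inj)
    show "(h \<circ> p) ` pverts house_graph \<subseteq> pverts (reg_graph S)"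
      using pR by (auto simp: reg_graph_def car inj simp flip: zero)
  next
    fix u v assume "u \<in> pverts house_graph" "v \<in> pverts house_graph"
    then show "((h \<circ> p) u, (h \<circ> p) v) \<in> parcs (reg_graph S) \<longleftrightarrow> (u, v) \<in> parcs house_graph"
      using p(3) pR(1) by (simp add: arcs)
  qed
qed

text \<open>The vertices \<open>a\<close>, \<open>b\<close>, \<open>c\<close>, \<open>d\<close> form
  the cycle in this order and \<open>e\<close> is the roof over the edge from \<open>a\<close> to
  \<open>b\<close>. The last four hypotheses are the non-edges: the two diagonals, and the roof
  against \<open>c\<close> and \<open>d\<close>.\<close>

lemma contains_houseI:
  fixes R (structure)
  assumes "{a, b, c, d, e} \<subseteq> carrier R - {\<zero>}" "distinct [a, b, c, d, e]"
    and "a \<otimes> b \<otimes> a = a \<or> b \<otimes> a \<otimes> b = b"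
    and "b \<otimes> c \<otimes> b = b \<or> c \<otimes> b \<otimes> c = c"
    and "c \<otimes> d \<otimes> c = c \<or> d \<otimes> c \<otimes> d = d"
    and "d \<otimes> a \<otimes> d = d \<or> a \<otimes> d \<otimes> a = a"
    and "e \<otimes> a \<otimes> e = e \<or> a \<otimes> e \<otimes> a = a"
    and "e \<otimes> b \<otimes> e = e \<or> b \<otimes> e \<otimes> b = b"
    and "\<not> (a \<otimes> c \<otimes> a = a \<or> c \<otimes> a \<otimes> c = c)"
    and "\<not> (b \<otimes> d \<otimes> b = b \<or> d \<otimes> b \<otimes> d = d)"
    and "\<not> (e \<otimes> c \<otimes> e = e \<or> c \<otimes> e \<otimes> c = c)"
    and "\<not> (e \<otimes> d \<otimes> e = e \<or> d \<otimes> e \<otimes> d = d)"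
  shows "contains_house R"
  unfolding contains_house_iff
  using assms
  by (intro exI[of _ "\<lambda>i. [a, b, c, d, e] ! i"])
    (auto simp: house_graph_simps reg_graph_def inj_on_def)

text \<open>A two-valued \<open>c\<close> cannot separate the three corners of a triangle. The
  hypothesis asks for different colours only when neither end is adjacent to all other vertices, and
  the triangle of an induced house has no such dominating corner.\<close>

lemma not_contains_house_if_bipartite_off_dominating:
  assumes "\<And>u v. (u, v) \<in> parcs (reg_graph R) \<Longrightarrow>
      \<exists>w \<in> pverts (reg_graph R). w \<noteq> u \<and> (u, w) \<notin> parcs (reg_graph R) \<Longrightarrow>
      \<exists>w \<in> pverts (reg_graph R). w \<noteq> v \<and> (v, w) \<notin> parcs (reg_graph R) \<Longrightarrow>
      c u \<noteq> (c v :: bool)"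
  shows "\<not> contains_house R"
proof
  assume "contains_house R"
  then obtain p where p: "inj_on p (pverts house_graph)"
    "p ` pverts house_graph \<subseteq> pverts (reg_graph R)"
    "\<And>u v. u \<in> pverts house_graph \<Longrightarrow> v \<in> pverts house_graph \<Longrightarrow>
      (p u, p v) \<in> parcs (reg_graph R) \<longleftrightarrow> (u, v) \<in> parcs house_graph"
    unfolding contains_house_iff by blast
  have nd: "\<exists>w \<in> pverts (reg_graph R). w \<noteq> p u \<and> (p u, w) \<notin> parcs (reg_graph R)"
    if "u \<in> pverts house_graph" "v \<in> pverts house_graph" "u \<noteq> v" "(u, v) \<notin> parcs house_graph"
    for u v
    using p that by (intro bexI[of _ "p v"]) (auto dest: inj_onD)
  \<comment> \<open>The triangle is 0, 1, 4; the non-neighbours of its corners inside the house are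
    2, 3, 2.\<close>
  have "c (p 0) \<noteq> c (p 1)" "c (p 1) \<noteq> c (p 4)" "c (p 0) \<noteq> c (p 4)"
    by (intro assms nd[of 0 2] nd[of 1 3] nd[of 4 2]; simp add: p(3) house_graph_simps)+
  then show False by auto
qed

section \<open>Rearranging direct products up to isomorphism\<close>

lemma RDirProd_simps:
  "carrier (RDirProd R S) = carrier R \<times> carrier S"
  "\<zero>\<^bsub>RDirProd R S\<^esub> = (\<zero>\<^bsub>R\<^esub>, \<zero>\<^bsub>S\<^esub>)"
  "\<one>\<^bsub>RDirProd R S\<^esub> = (\<one>\<^bsub>R\<^esub>, \<one>\<^bsub>S\<^esub>)"
  "(a, b) \<otimes>\<^bsub>RDirProd R S\<^esub> (c, d) = (a \<otimes>\<^bsub>R\<^esub> c, b \<otimes>\<^bsub>S\<^esub> d)"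
  by (auto simp: RDirProd_def DirProd_def monoid.defs)

lemmas [trans] = ring_iso_trans

lemma RDirProd_cong:
  assumes "R \<simeq> R'" "S \<simeq> S'"
  shows "RDirProd R S \<simeq> RDirProd R' S'"
  using assms RDirProd_iso6 unfolding is_ring_iso_def by blast

lemma RDirProd_comm: "RDirProd R S \<simeq> RDirProd S R"
  using RDirProd_iso1 unfolding is_ring_iso_def by blast

lemma RDirProd_left_commute: "RDirProd R (RDirProd S T) \<simeq> RDirProd S (RDirProd R T)"
proof -
  have "RDirProd R (RDirProd S T) \<simeq> RDirProd (RDirProd R S) T"
    using RDirProd_iso2 unfolding is_ring_iso_def by blast
  also have "\<dots> \<simeq> RDirProd (RDirProd S R) T"
    by (intro RDirProd_cong RDirProd_comm ring_iso_refl)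
  also have "\<dots> \<simeq> RDirProd S (RDirProd R T)"
    using RDirProd_iso3 unfolding is_ring_iso_def by blast
  finally show ?thesis .
qed

text \<open>This and its converse are kept separately because \<open>ring_iso_sym\<close> asks for a
  ring, whereas both directions hold for arbitrary structures.\<close>

lemma RDirProd_list_Cons_iso: "RDirProd_list (R # Rs) \<simeq> RDirProd R (RDirProd_list Rs)"
  using RDirProd_list_iso2 unfolding is_ring_iso_def by blast

lemma RDirProd_list_Cons_iso': "RDirProd R (RDirProd_list Rs) \<simeq> RDirProd_list (R # Rs)"
  using RDirProd_list_iso1 unfolding is_ring_iso_def by blast

lemma RDirProd_list_single_iso: "ring R \<Longrightarrow> RDirProd_list [R] \<simeq> R"
  using RDirProd_list_iso3 ring_iso_sym unfolding is_ring_iso_def by blast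

lemma RDirProd_list_single_iso': "R \<simeq> RDirProd_list [R]"
  using RDirProd_list_iso3 unfolding is_ring_iso_def by blast

lemma RDirProd_list_pair_iso:
  "ring S \<Longrightarrow> RDirProd_list [R, S] \<simeq> RDirProd R S"
  "RDirProd R S \<simeq> RDirProd_list [R, S]"
  using ring_iso_trans[OF RDirProd_list_Cons_iso
      RDirProd_cong[OF ring_iso_refl RDirProd_list_single_iso]]
    ring_iso_trans[OF RDirProd_cong[OF ring_iso_refl RDirProd_list_single_iso']
      RDirProd_list_Cons_iso']
  by blast+

lemma RDirProd_list_triple_iso:
  "ring T \<Longrightarrow> RDirProd_list [R, S, T] \<simeq> RDirProd R (RDirProd S T)"
  "RDirProd R (RDirProd S T) \<simeq> RDirProd_list [R, S, T]"
  using ring_iso_trans[OF RDirProd_list_Cons_iso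
      RDirProd_cong[OF ring_iso_refl RDirProd_list_pair_iso(1)]]
    ring_iso_trans[OF RDirProd_cong[OF ring_iso_refl RDirProd_list_pair_iso(2)]
      RDirProd_list_Cons_iso']
  by blast+

text \<open>A factor with special elements may stand anywhere in the list, while the houses below
  are built with it in first position. Induction on the prefix moves it forward past one factor at a
  time.\<close>

lemma RDirProd_list_extract_iso:
  "RDirProd_list (Rs @ R # Ss) \<simeq> RDirProd R (RDirProd_list (Rs @ Ss))"
proof (induction Rs)
  case Nil
  show ?case using RDirProd_list_Cons_iso by simp
next
  case (Cons Q Rs)
  have "RDirProd_list (Q # Rs @ R # Ss) \<simeq> RDirProd Q (RDirProd_list (Rs @ R # Ss))"
    by (rule RDirProd_list_Cons_iso)
  also have "\<dots> \<simeq> RDirProd Q (RDirProd R (RDirProd_list (Rs @ Ss)))"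
    by (rule RDirProd_cong[OF ring_iso_refl Cons])
  also have "\<dots> \<simeq> RDirProd R (RDirProd Q (RDirProd_list (Rs @ Ss)))"
    by (rule RDirProd_left_commute)
  also have "\<dots> \<simeq> RDirProd R (RDirProd_list (Q # Rs @ Ss))"
    by (rule RDirProd_cong[OF ring_iso_refl RDirProd_list_Cons_iso'])
  finally show ?case by simp
qed

lemma RDirProd_list_one_neq_zero:
  assumes "Rs \<noteq> []" "\<And>R. R \<in> set Rs \<Longrightarrow> \<one>\<^bsub>R\<^esub> \<noteq> \<zero>\<^bsub>R\<^esub>"
  shows "\<one>\<^bsub>RDirProd_list Rs\<^esub> \<noteq> \<zero>\<^bsub>RDirProd_list Rs\<^esub>"
  using assms by (cases Rs) (auto simp: RDirProd_list_one RDirProd_list_zero)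

section \<open>Products that contain a house\<close>

text \<open>The condition on \<open>u\<close> says that \<open>u\<close> differs from its inverse
  \<open>v\<close>. Then neither element equals its own cube, which removes both diagonals of the
  cycle, and the roof annihilates the two vertices whose second entry is zero. Of \<open>S\<close>
  only zero and one occur, so all other factors can be collected in it.\<close>

lemma contains_house_field_nontrivial:
  assumes "field F" "ring S" "\<one>\<^bsub>S\<^esub> \<noteq> \<zero>\<^bsub>S\<^esub>"
    and u: "u \<in> carrier F" "u \<noteq> \<zero>\<^bsub>F\<^esub>" "u \<otimes>\<^bsub>F\<^esub> u \<noteq> \<one>\<^bsub>F\<^esub>"
  shows "contains_house (RDirProd F S)"
proof -
  interpret F: field F by fact
  interpret S: ring S by fact
  define v where "v = inv\<^bsub>F\<^esub> u"
  have "u \<in> Units F" using u F.field_Units by auto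
  then have v: "v \<in> carrier F" "u \<otimes>\<^bsub>F\<^esub> v = \<one>\<^bsub>F\<^esub>" "v \<otimes>\<^bsub>F\<^esub> u = \<one>\<^bsub>F\<^esub>"
    by (auto simp: v_def)
  have "v \<noteq> \<zero>\<^bsub>F\<^esub>" "u \<noteq> v" using u v by auto
  have u3: "u \<otimes>\<^bsub>F\<^esub> u \<otimes>\<^bsub>F\<^esub> u \<noteq> u"
  proof
    assume "u \<otimes>\<^bsub>F\<^esub> u \<otimes>\<^bsub>F\<^esub> u = u"
    then have "u \<otimes>\<^bsub>F\<^esub> u \<otimes>\<^bsub>F\<^esub> u \<otimes>\<^bsub>F\<^esub> v = u \<otimes>\<^bsub>F\<^esub> v" by simp
    with u v show False by (simp add: F.m_assoc)
  qed
  have v3: "v \<otimes>\<^bsub>F\<^esub> v \<otimes>\<^bsub>F\<^esub> v \<noteq> v"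
  proof
    assume "v \<otimes>\<^bsub>F\<^esub> v \<otimes>\<^bsub>F\<^esub> v = v"
    then have "v \<otimes>\<^bsub>F\<^esub> v \<otimes>\<^bsub>F\<^esub> v \<otimes>\<^bsub>F\<^esub> u = v \<otimes>\<^bsub>F\<^esub> u" by simp
    then have "v \<otimes>\<^bsub>F\<^esub> v = \<one>\<^bsub>F\<^esub>" using u v by (simp add: F.m_assoc)
    then have "u \<otimes>\<^bsub>F\<^esub> (v \<otimes>\<^bsub>F\<^esub> v) = u" using u v by simp
    then have "v = u" using u v by (simp flip: F.m_assoc)
    with \<open>u \<noteq> v\<close> show False by simp
  qed
  let ?z = "\<zero>\<^bsub>S\<^esub>" and ?o = "\<one>\<^bsub>S\<^esub>"
  show ?thesis
    by (rule contains_houseI[where a = "(u, ?o)" and b = "(v, ?o)" and c = "(u, ?z)"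
          and d = "(v, ?z)" and e = "(\<zero>\<^bsub>F\<^esub>, ?o)"])
      (use u v u3 v3 \<open>u \<noteq> v\<close> \<open>v \<noteq> \<zero>\<^bsub>F\<^esub>\<close> assms(3) in \<open>auto simp: RDirProd_simps\<close>)
qed

text \<open>Here \<open>u\<close> plays the role of -1. The vertices \<open>b\<close> and
  \<open>d\<close> have full support and differ only in the sign of the first entry: they are not
  adjacent, but both are adjacent to \<open>a\<close> and \<open>c\<close>, whose first entry is
  zero. The roof \<open>e\<close> has first entry one and thus tells \<open>b\<close> from
  \<open>d\<close>; its support contains that of \<open>a\<close> and is disjoint from that of
  \<open>c\<close>.\<close>

lemma contains_house_three_factors:
  assumes "field F" "ring S" "\<one>\<^bsub>S\<^esub> \<noteq> \<zero>\<^bsub>S\<^esub>" "ring T" "\<one>\<^bsub>T\<^esub> \<noteq> \<zero>\<^bsub>T\<^esub>"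
    and u: "u \<in> carrier F" "u \<noteq> \<zero>\<^bsub>F\<^esub>" "u \<noteq> \<one>\<^bsub>F\<^esub>" "u \<otimes>\<^bsub>F\<^esub> u = \<one>\<^bsub>F\<^esub>"
  shows "contains_house (RDirProd F (RDirProd S T))"
proof -
  interpret F: field F by fact
  interpret S: ring S by fact
  interpret T: ring T by fact
  show ?thesis
    by (rule contains_houseI[where a = "(\<zero>\<^bsub>F\<^esub>, \<one>\<^bsub>S\<^esub>, \<zero>\<^bsub>T\<^esub>)" and b = "(\<one>\<^bsub>F\<^esub>, \<one>\<^bsub>S\<^esub>, \<one>\<^bsub>T\<^esub>)"
          and c = "(\<zero>\<^bsub>F\<^esub>, \<zero>\<^bsub>S\<^esub>, \<one>\<^bsub>T\<^esub>)" and d = "(u, \<one>\<^bsub>S\<^esub>, \<one>\<^bsub>T\<^esub>)"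
          and e = "(\<one>\<^bsub>F\<^esub>, \<one>\<^bsub>S\<^esub>, \<zero>\<^bsub>T\<^esub>)"])
      (use u assms(3,5) in \<open>auto simp: RDirProd_simps\<close>)
qed

text \<open>Between tuples of zeros and ones adjacency is inclusion of supports. The supports used
  are {1}, {1,2,3}, {2}, {1,2,4} and, for the roof, {1,3}.\<close>

lemma contains_house_four_factors:
  assumes "ring R" "\<one>\<^bsub>R\<^esub> \<noteq> \<zero>\<^bsub>R\<^esub>" "ring S" "\<one>\<^bsub>S\<^esub> \<noteq> \<zero>\<^bsub>S\<^esub>"
    and "ring T" "\<one>\<^bsub>T\<^esub> \<noteq> \<zero>\<^bsub>T\<^esub>" "ring U" "\<one>\<^bsub>U\<^esub> \<noteq> \<zero>\<^bsub>U\<^esub>"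
  shows "contains_house (RDirProd R (RDirProd S (RDirProd T U)))"
proof -
  interpret R: ring R by fact
  interpret S: ring S by fact
  interpret T: ring T by fact
  interpret U: ring U by fact
  show ?thesis
    by (rule contains_houseI[where a = "(\<one>\<^bsub>R\<^esub>, \<zero>\<^bsub>S\<^esub>, \<zero>\<^bsub>T\<^esub>, \<zero>\<^bsub>U\<^esub>)"
          and b = "(\<one>\<^bsub>R\<^esub>, \<one>\<^bsub>S\<^esub>, \<one>\<^bsub>T\<^esub>, \<zero>\<^bsub>U\<^esub>)" and c = "(\<zero>\<^bsub>R\<^esub>, \<one>\<^bsub>S\<^esub>, \<zero>\<^bsub>T\<^esub>, \<zero>\<^bsub>U\<^esub>)"
          and d = "(\<one>\<^bsub>R\<^esub>, \<one>\<^bsub>S\<^esub>, \<zero>\<^bsub>T\<^esub>, \<one>\<^bsub>U\<^esub>)" and e = "(\<one>\<^bsub>R\<^esub>, \<zero>\<^bsub>S\<^esub>, \<one>\<^bsub>T\<^esub>, \<zero>\<^bsub>U\<^esub>)"])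
      (use assms(2,4,6,8) in \<open>auto simp: RDirProd_simps\<close>)
qed

section \<open>Fields in which every nonzero element squares to one\<close>

lemma ring_residue_ring: "m > 1 \<Longrightarrow> ring (residue_ring m)"
  using residues.cring[OF residues.intro] cring.axioms(1) by blast

text \<open>If every nonzero \<open>u\<close> satisfies \<open>u \<otimes> u = \<one>\<close>, then
  (u - 1)(u + 1) = 0 leaves only 0, 1 and -1, and the field has two or three elements according to
  whether 1 = -1. The third case also hands over an element, for use in
  \<open>contains_house_three_factors\<close>.\<close>

lemma field_cases:
  fixes F (structure)
  assumes "field F"
  obtains (big) u where "u \<in> carrier F" "u \<noteq> \<zero>" "u \<otimes> u \<noteq> \<one>"
  | (two) "F \<simeq> residue_ring 2"
  | (three) u where "F \<simeq> residue_ring 3" "u \<in> carrier F" "u \<noteq> \<zero>" "u \<noteq> \<one>" "u \<otimes> u = \<one>"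
proof (cases "\<forall>u \<in> carrier F. u = \<zero> \<or> u \<otimes> u = \<one>")
  case False
  then show ?thesis using big by blast
next
  case True
  interpret field F by fact
  have roots: "u = \<one> \<or> u = \<ominus> \<one>" if "u \<in> carrier F" "u \<noteq> \<zero>" for u
  proof -
    have "(u \<ominus> \<one>) \<otimes> (u \<oplus> \<one>) = u \<otimes> u \<ominus> \<one>"
      using that by algebra
    also have "\<dots> = \<zero>" using True that by (auto simp: minus_eq r_neg)
    finally have "u \<ominus> \<one> = \<zero> \<or> u \<oplus> \<one> = \<zero>"
      using that by (intro integral) auto
    then show ?thesis
      using that by (metis minus_equality one_closed r_right_minus_eq)
  qed
  have car: "carrier F = {\<zero>, \<one>, \<ominus> \<one>}" using roots by auto
  show ?thesis
  proof (cases "\<one> = \<ominus> \<one>")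
    case eq: True
    have o2: "\<one> \<oplus> \<one> = \<zero>" by (metis eq one_closed r_neg)
    have car2: "carrier (residue_ring 2) = {0, 1}"
      by (auto simp: residue_ring_def)
    have "(\<lambda>k. if k = 0 then \<zero> else \<one>) \<in> ring_iso (residue_ring 2) F"
    proof (rule ring_iso_memI)
      show "bij_betw (\<lambda>k::int. if k = 0 then \<zero> else \<one>) (carrier (residue_ring 2)) (carrier F)"
        unfolding car2 car using eq by (auto simp: bij_betw_def inj_on_def)
    qed (unfold car2, use o2 in \<open>auto simp: residue_ring_def\<close>)
    then have "residue_ring 2 \<simeq> F" unfolding is_ring_iso_def by blast
    then show ?thesis using two ring_iso_sym ring_residue_ring by force
  next
    case neq: False
    have m0: "\<ominus> \<one> \<noteq> \<zero>" using car by (metis minus_minus minus_zero one_closed one_not_zero)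
    have "\<one> \<oplus> \<one> \<noteq> \<zero>" using neq by (metis minus_equality one_closed)
    moreover have "\<one> \<oplus> \<one> \<noteq> \<one>" by (metis add.l_cancel_one' one_closed one_not_zero)
    \<comment> \<open>In a three-element carrier, excluding 0 and 1 determines 1 + 1, and with it
      the addition table.\<close>
    ultimately have o2: "\<one> \<oplus> \<one> = \<ominus> \<one>" using car by blast
    have m2: "\<ominus> \<one> \<oplus> \<ominus> \<one> = \<one>"
      using o2 by (metis minus_add minus_minus one_closed)
    have car3: "carrier (residue_ring 3) = {0, 1, 2}"
      by (auto simp: residue_ring_def)
    have "(\<lambda>k. if k = 0 then \<zero> else if k = 1 then \<one> else \<ominus> \<one>) \<in> ring_iso (residue_ring 3) F"
    proof (rule ring_iso_memI)
      show "bij_betw (\<lambda>k::int. if k = 0 then \<zero> else if k = 1 then \<one> else \<ominus> \<one>)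
          (carrier (residue_ring 3)) (carrier F)"
        unfolding car3 car using neq m0 m0[symmetric] by (auto simp: bij_betw_def inj_on_def)
    qed (unfold car3, use o2 m2 in \<open>auto simp: residue_ring_def l_neg r_neg l_minus r_minus\<close>)
    then have "residue_ring 3 \<simeq> F" unfolding is_ring_iso_def by blast
    then have "F \<simeq> residue_ring 3" using ring_iso_sym ring_residue_ring by force
    \<comment> \<open>The element supplied is -1.\<close>
    then show ?thesis
      using three[OF _ _ m0 neq[symmetric]] by (simp add: l_minus)
  qed
qed

section \<open>The house-free rings\<close>

text \<open>Colour a vertex by whether both entries are nonzero. Nonzero residues modulo 2 or 3 are
  their own inverses, so distinct vertices with equal support are not adjacent, and neither are
  vertices with disjoint supports. Hence every edge joins a full support to a singleton.\<close>

lemma not_contains_house_residue_pair: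
  assumes "m \<in> {2, 3}" "k \<in> {2, 3}"
  shows "\<not> contains_house (RDirProd (residue_ring m) (residue_ring k))"
    (is "\<not> contains_house ?R")
proof (rule not_contains_house_if_bipartite_off_dominating
    [where c = "\<lambda>(x, y). x \<noteq> 0 \<and> y \<noteq> 0"])
  fix u v assume uv: "(u, v) \<in> parcs (reg_graph ?R)"
  obtain x y x' y' where u: "u = (x, y)" and v: "v = (x', y')" by fastforce
  have "u \<in> carrier ?R" "v \<in> carrier ?R"
    using uv by (simp_all add: reg_graph_def)
  then have "x \<in> {0..m - 1}" "y \<in> {0..k - 1}" "x' \<in> {0..m - 1}" "y' \<in> {0..k - 1}"
    by (simp_all add: u v RDirProd_simps residue_ring_def)
  \<comment> \<open>For modulus 2 the range is deliberately too large: a single case distinction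
    then serves both moduli, and the claim survives the extra value 2.\<close>
  then have range: "x \<in> {0, 1, 2}" "y \<in> {0, 1, 2}" "x' \<in> {0, 1, 2}" "y' \<in> {0, 1, 2}"
    using assms by auto
  have "(x, y) \<noteq> (0, 0)" "(x', y') \<noteq> (0, 0)" "(x, y) \<noteq> (x', y')"
    "x * x' mod m * x mod m = x \<and> y * y' mod k * y mod k = y \<or>
     x' * x mod m * x' mod m = x' \<and> y' * y mod k * y' mod k = y'"
    using uv by (auto simp: u v reg_graph_def RDirProd_simps residue_ring_def)
  then have "(x \<noteq> 0 \<and> y \<noteq> 0) \<noteq> (x' \<noteq> 0 \<and> y' \<noteq> 0)"
    using range assms by - (elim insertE emptyE; simp)
  then show "(case u of (x, y) \<Rightarrow> x \<noteq> 0 \<and> y \<noteq> 0) \<noteq> (case v of (x, y) \<Rightarrow> x \<noteq> 0 \<and> y \<noteq> 0)"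
    by (simp add: u v)
qed

text \<open>Vertices are the nonempty subsets of a three-element set and adjacency is inclusion. The
  whole set dominates; the remaining edges join singletons to pairs. The sum in the colouring is an
  integer sum, so it counts the support.\<close>

lemma not_contains_house_residue_triple:
  "\<not> contains_house (RDirProd (residue_ring 2) (RDirProd (residue_ring 2) (residue_ring 2)))"
  (is "\<not> contains_house ?R")
proof (rule not_contains_house_if_bipartite_off_dominating
    [where c = "\<lambda>(x, y, z). x + y + z = 1"])
  have range: "x \<in> {0, 1}" "y \<in> {0, 1}" "z \<in> {0, 1}"
    if "(x, y, z) \<in> pverts (reg_graph ?R)" for x y z
    using that by (auto simp: reg_graph_def RDirProd_simps residue_ring_def)
  have full: "((1, 1, 1), w) \<in> parcs (reg_graph ?R)"
    if "w \<in> pverts (reg_graph ?R)" "w \<noteq> (1, 1, 1)" for w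
  proof -
    obtain x y z where w: "w = (x, y, z)" by (metis prod.exhaust)
    have "x * x mod 2 = x \<and> y * y mod 2 = y \<and> z * z mod 2 = z"
      using range that(1) unfolding w by fastforce
    then show ?thesis
      using that by (auto simp: w reg_graph_def RDirProd_simps residue_ring_def)
  qed
  fix u v
  assume uv: "(u, v) \<in> parcs (reg_graph ?R)"
    and "\<exists>w \<in> pverts (reg_graph ?R). w \<noteq> u \<and> (u, w) \<notin> parcs (reg_graph ?R)"
    and "\<exists>w \<in> pverts (reg_graph ?R). w \<noteq> v \<and> (v, w) \<notin> parcs (reg_graph ?R)"
  then have nf: "u \<noteq> (1, 1, 1)" "v \<noteq> (1, 1, 1)" using full by blast+
  obtain x y z x' y' z' where u: "u = (x, y, z)" and v: "v = (x', y', z')"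
    by (metis prod.exhaust)
  have "u \<in> pverts (reg_graph ?R)" "v \<in> pverts (reg_graph ?R)"
    using uv by (auto simp: reg_graph_def)
  note range' = range[OF this(1)[unfolded u]] range[OF this(2)[unfolded v]]
  have "(x, y, z) \<noteq> (0, 0, 0)" "(x', y', z') \<noteq> (0, 0, 0)" "(x, y, z) \<noteq> (x', y', z')"
    "x * x' mod 2 * x mod 2 = x \<and> y * y' mod 2 * y mod 2 = y \<and> z * z' mod 2 * z mod 2 = z \<or>
     x' * x mod 2 * x' mod 2 = x' \<and> y' * y mod 2 * y' mod 2 = y' \<and> z' * z mod 2 * z' mod 2 = z'"
    using uv by (auto simp: u v reg_graph_def RDirProd_simps residue_ring_def)
  then have "(x + y + z = 1) \<noteq> (x' + y' + z' = 1)"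
    using range' nf unfolding u v by - (elim insertE emptyE; simp)
  then show "(case u of (x, y, z) \<Rightarrow> x + y + z = 1) \<noteq> (case v of (x, y, z) \<Rightarrow> x + y + z = 1)"
    by (simp add: u v)
qed

section \<open>Classification by the number of factors and their sizes\<close>

theorem theorem9:
  fixes R :: "('a, 'm) ring_scheme" and Fs :: "('b, 'k) ring_scheme list" and n :: nat
  assumes "n \<ge> 2"
    and "length Fs = n"
    and "\<And>F. F \<in> set Fs \<Longrightarrow> field F \<and> finite (carrier F)"
    and "cring R"
    and "R \<simeq> RDirProd_list Fs"
  shows "\<not> contains_induced (with_proj (reg_graph R)) (with_proj house_graph) \<longleftrightarrow>
      R \<simeq> RDirProd_list [residue_ring 2, residue_ring 2] \<or>
      R \<simeq> RDirProd_list [residue_ring 2, residue_ring 3] \<or>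
      R \<simeq> RDirProd_list [residue_ring 3, residue_ring 3] \<or>
      R \<simeq> RDirProd_list [residue_ring 2, residue_ring 2, residue_ring 2]"
proof -
  let ?Z2 = "residue_ring 2" and ?Z3 = "residue_ring 3"
  have Z: "ring ?Z2" "ring ?Z3" by (simp_all add: ring_residue_ring)
  have R: "ring R" using assms(4) by (rule cring.axioms(1))
  have F: "field F" "ring F" "\<one>\<^bsub>F\<^esub> \<noteq> \<zero>\<^bsub>F\<^esub>" if "F \<in> set Fs" for F
  proof -
    show "field F" using assms(3) that by blast
    then interpret field F .
    show "ring F" by (rule ring_axioms)
    show "\<one>\<^bsub>F\<^esub> \<noteq> \<zero>\<^bsub>F\<^esub>" by simp
  qed
  have ring_list: "ring (RDirProd_list Gs)" if "set Gs \<subseteq> set Fs" for Gs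
    using that F(2) by (intro RDirProd_list_is_ring) (meson nth_mem subsetD)
  have one_list: "\<one>\<^bsub>RDirProd_list Gs\<^esub> \<noteq> \<zero>\<^bsub>RDirProd_list Gs\<^esub>"
    if "set Gs \<subseteq> set Fs" "Gs \<noteq> []" for Gs
    using that F(3) by (intro RDirProd_list_one_neq_zero) auto
  show ?thesis (is "?L \<longleftrightarrow> ?iso")
  proof
    assume ?iso
    then consider
        (pair) m k where "m \<in> {2, 3}" "k \<in> {2, 3}"
          "R \<simeq> RDirProd_list [residue_ring m, residue_ring k]"
      | (triple) "R \<simeq> RDirProd_list [?Z2, ?Z2, ?Z2]"
      by blast
    then show ?L
    proof cases
      case pair
      then have "ring (residue_ring m)" "ring (residue_ring k)"
        by (auto intro: ring_residue_ring)
      then show ?thesis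
        using pair contains_house_iso[OF R RDirProd_ring] not_contains_house_residue_pair
          ring_iso_trans[OF pair(3) RDirProd_list_pair_iso(1)] by blast
    next
      case triple
      then show ?thesis
        using contains_house_iso[OF R RDirProd_ring[OF Z(1) RDirProd_ring[OF Z(1) Z(1)]]]
          not_contains_house_residue_triple
          ring_iso_trans[OF triple RDirProd_list_triple_iso(1)] Z(1) by blast
    qed
  next
    assume noh: ?L
    \<comment> \<open>The carrier type of \<open>S\<close> is left general, since the fact is
      applied to nested products of different shapes.\<close>
    have no_house: "\<not> contains_house S" if "ring S" "RDirProd_list Fs \<simeq> S" for S :: "'c ring"
      using noh contains_house_iso[OF that(1) R]
        ring_iso_sym[OF R ring_iso_trans[OF assms(5) that(2)]] by blast
    have split: "\<exists>Gs. set Gs \<subseteq> set Fs \<and> length Gs = n - 1 \<and>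
        RDirProd_list Fs \<simeq> RDirProd F (RDirProd_list Gs)" if FF: "F \<in> set Fs" for F
    proof -
      obtain As Bs where "Fs = As @ F # Bs" using split_list[OF FF] by blast
      then show ?thesis
        using RDirProd_list_extract_iso[of As F Bs] assms(2) by (intro exI[of _ "As @ Bs"]) auto
    qed
    have not_big: False if FF: "F \<in> set Fs"
      and u: "u \<in> carrier F" "u \<noteq> \<zero>\<^bsub>F\<^esub>" "u \<otimes>\<^bsub>F\<^esub> u \<noteq> \<one>\<^bsub>F\<^esub>" for F u
    proof -
      obtain Gs where Gs: "set Gs \<subseteq> set Fs" "length Gs = n - 1"
        and iso: "RDirProd_list Fs \<simeq> RDirProd F (RDirProd_list Gs)"
        using split[OF FF] by blast
      then have "Gs \<noteq> []" using assms(1) by auto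
      then show False
        using no_house[OF RDirProd_ring[OF F(2)[OF FF] ring_list[OF Gs(1)]] iso]
          contains_house_field_nontrivial[OF F(1)[OF FF] ring_list[OF Gs(1)]
            one_list[OF Gs(1)] u] by simp
    qed
    \<comment> \<open>A field of three elements together with at least two further factors falls
      under \<open>contains_house_three_factors\<close>, so it can occur only when there are two
      factors.\<close>
    have small: "F \<simeq> ?Z2 \<or> n = 2 \<and> F \<simeq> ?Z3" if FF: "F \<in> set Fs" for F
      using F(1)[OF FF]
    proof (cases rule: field_cases)
      case (three u)
      obtain Gs where Gs: "set Gs \<subseteq> set Fs" "length Gs = n - 1"
        and iso: "RDirProd_list Fs \<simeq> RDirProd F (RDirProd_list Gs)"
        using split[OF FF] by blast
      have "n = 2"
      proof (rule ccontr)
        assume "n \<noteq> 2"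
        then obtain G Hs where GH: "Gs = G # Hs" "Hs \<noteq> []"
          using Gs(2) assms(1) by (cases Gs; cases "tl Gs") auto
        have sub: "G \<in> set Fs" "set Hs \<subseteq> set Fs" using Gs(1) GH(1) by auto
        have iso': "RDirProd_list Fs \<simeq> RDirProd F (RDirProd G (RDirProd_list Hs))"
          by (rule ring_iso_trans[OF iso[unfolded GH(1)]
                RDirProd_cong[OF ring_iso_refl RDirProd_list_Cons_iso]])
        show False
          using no_house[OF RDirProd_ring[OF F(2)[OF FF]
                RDirProd_ring[OF F(2)[OF sub(1)] ring_list[OF sub(2)]]] iso']
            contains_house_three_factors[OF F(1)[OF FF] F(2,3)[OF sub(1)] ring_list[OF sub(2)]
              one_list[OF sub(2) GH(2)] three(2-5)] by simp
      qed
      then show ?thesis using three(1) by simp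
    qed (use not_big[OF FF] in auto)
    have "n < 4"
    proof (rule ccontr)
      assume "\<not> n < 4"
      \<comment> \<open>All factors after the third are collected in the nontrivial ring
        \<open>RDirProd_list Ds\<close>, which acts as the fourth factor.\<close>
      then obtain A B C Ds where Fs: "Fs = A # B # C # Ds" "Ds \<noteq> []"
        using assms(2) by (cases Fs; cases "tl Fs"; cases "tl (tl Fs)"; cases "tl (tl (tl Fs))") auto
      have sub: "A \<in> set Fs" "B \<in> set Fs" "C \<in> set Fs" "set Ds \<subseteq> set Fs"
        using Fs(1) by auto
      have "RDirProd_list Fs \<simeq> RDirProd A (RDirProd_list (B # C # Ds))"
        unfolding Fs(1) by (rule RDirProd_list_Cons_iso)
      also have "\<dots> \<simeq> RDirProd A (RDirProd B (RDirProd_list (C # Ds)))"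
        by (intro RDirProd_cong ring_iso_refl RDirProd_list_Cons_iso)
      also have "\<dots> \<simeq> RDirProd A (RDirProd B (RDirProd C (RDirProd_list Ds)))"
        by (intro RDirProd_cong ring_iso_refl RDirProd_list_Cons_iso)
      finally have iso:
        "RDirProd_list Fs \<simeq> RDirProd A (RDirProd B (RDirProd C (RDirProd_list Ds)))" .
      show False
        using no_house[OF RDirProd_ring[OF F(2)[OF sub(1)] RDirProd_ring[OF F(2)[OF sub(2)]
                RDirProd_ring[OF F(2)[OF sub(3)] ring_list[OF sub(4)]]]] iso]
          contains_house_four_factors[OF F(2,3)[OF sub(1)] F(2,3)[OF sub(2)] F(2,3)[OF sub(3)]
            ring_list[OF sub(4)] one_list[OF sub(4) Fs(2)]] by simp
    qed
    with assms(1) consider "n = 2" | "n = 3" by linarith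
    then show ?iso
    proof cases
      case 1
      then obtain A B where Fs: "Fs = [A, B]"
        using assms(2) by (auto simp: numeral_2_eq_2 length_Suc_conv)
      have R2: "R \<simeq> RDirProd A B"
        using ring_iso_trans[OF assms(5)[unfolded Fs] RDirProd_list_pair_iso(1)] F(2) Fs by simp
      have into: "R \<simeq> RDirProd_list [S, T]" if "A \<simeq> S" "B \<simeq> T" for S T :: "int ring"
        by (rule ring_iso_trans[OF R2 ring_iso_trans[OF RDirProd_cong[OF that]
                RDirProd_list_pair_iso(2)]])
      \<comment> \<open>Needed when the factors come as three elements first and two elements
        second, since the statement lists the mixed pair in one order only.\<close>
      have swap: "R \<simeq> RDirProd_list [T, S]" if "A \<simeq> S" "B \<simeq> T" for S T :: "int ring"
        by (rule ring_iso_trans[OF R2 ring_iso_trans[OF RDirProd_cong[OF that]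
                ring_iso_trans[OF RDirProd_comm RDirProd_list_pair_iso(2)]]])
      show ?thesis using small[of A] small[of B] Fs into swap by auto
    next
      case 2
      then obtain A B C where Fs: "Fs = [A, B, C]"
        using assms(2) by (auto simp: numeral_3_eq_3 length_Suc_conv)
      then have ABC: "A \<simeq> ?Z2" "B \<simeq> ?Z2" "C \<simeq> ?Z2" using small 2 by auto
      have "R \<simeq> RDirProd A (RDirProd B C)"
        using ring_iso_trans[OF assms(5)[unfolded Fs] RDirProd_list_triple_iso(1)] F(2) Fs by simp
      also have "\<dots> \<simeq> RDirProd ?Z2 (RDirProd ?Z2 ?Z2)"
        by (intro RDirProd_cong ABC)
      also have "\<dots> \<simeq> RDirProd_list [?Z2, ?Z2, ?Z2]"
        by (rule RDirProd_list_triple_iso(2))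
      finally show ?thesis by blast
    qed
  qed
qed

end
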